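(* Let $G=(V,E)$ be a finite simple connected graph, $M_G=(m_{vw})_{v,w\in V}$ a real symmetric matrix, and $\Delta_G=\operatorname{diag}(f_v)_{v\in V}$ with all $f_v\in\mathbb{R}\setminus\{0\}$. Let $p_{\mathcal{A}_G}$ be the $\mathcal{A}$-blowup-polynomial. Then the homogeneous quadratic part of $p_{\mathcal{A}_G}$, i.e. its Hessian at the origin, equals $$\mathcal{H}(p_{\mathcal{A}_G}):=\bigl(\partial_{n_v}\partial_{n_{v'}}p_{\mathcal{A}_G}\bigr)_{v,v'\in V}\Big|_{\mathbf{n}=\mathbf{0}}=\prod_{v\in V}f_v\cdot\Delta_G^{-1}\bigl(\mathbf{m}_G\mathbf{m}_G^T-M_G^{\circ2}\bigr)\Delta_G^{-1},$$ where $\mathbf{m}_G:=(m_{vv})_{v\in V}\in\mathbb{R}^V$ is the column vector of diagonal entries of $M_G$. Thus, if the scalars $f_v,m_{vv}$ ($v\in V$) are known, then the polynomial $p_{\mathcal{A}_G}(\mathbf{n})$ detects (i.e. uniquely determines) the matrix $M_G^{\circ2}$.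
   Context: The $\mathcal{A}$-blowup-polynomial of $G$, attached to $\mathcal{A}_G:=\Delta_G+M_G$, is the multi-affine polynomial $p_{\mathcal{A}_G}(\mathbf{n}):=\det(\Delta_G+\Delta_{\mathbf{n}}M_G)$ in the variables $\mathbf{n}=(n_v)_{v\in V}$, where $\Delta_{\mathbf{n}}:=\operatorname{diag}(n_v)_{v\in V}$. $M_G^{\circ2}:=(m_{vw}^2)_{v,w\in V}$ is the Hadamard (entrywise) square of $M_G$. *)

theory Defs
  imports "HOL-Analysis.Analysis" "Graph_Theory.Digraph_Component"
begin

definition diag_mat :: "real ^ 'v \<Rightarrow> real ^ 'v ^ 'v" where
  "diag_mat d = (\<chi> v w. if v = w then d $ v else 0)"

definition hadamard_square :: "real ^ 'v ^ 'v \<Rightarrow> real ^ 'v ^ 'v" where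
  "hadamard_square M = (\<chi> v w. (M $ v $ w)\<^sup>2)"

definition diagonal_vec :: "real ^ 'v ^ 'v \<Rightarrow> real ^ 'v" where
  "diagonal_vec M = (\<chi> v. M $ v $ v)"

text \<open>
  The blowup polynomial attached to \<open>diag_mat f + M\<close>, as a polynomial function of the vector of
  variables \<open>n\<close>; over the reals, polynomials and polynomial functions coincide. It depends on the
  pair \<open>(f, M)\<close>, not only on the sum \<open>diag_mat f + M\<close>.
\<close>

definition blowup_poly :: "real ^ 'v \<Rightarrow> real ^ 'v ^ 'v \<Rightarrow> real ^ 'v \<Rightarrow> real" where
  "blowup_poly f M n = det (diag_mat f + diag_mat n ** M)"

definition partial_deriv :: "'v \<Rightarrow> (real ^ 'v \<Rightarrow> real) \<Rightarrow> real ^ 'v \<Rightarrow> real" where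
  "partial_deriv v p x = deriv (\<lambda>t. p (x + t *\<^sub>R axis v 1)) 0"

definition hessian :: "(real ^ 'v \<Rightarrow> real) \<Rightarrow> real ^ 'v \<Rightarrow> real ^ 'v ^ 'v" where
  "hessian p x = (\<chi> v w. partial_deriv v (partial_deriv w p) x)"

definition homogeneous_polynomial :: "nat \<Rightarrow> (real ^ 'v \<Rightarrow> real) \<Rightarrow> bool" where
  "homogeneous_polynomial k q \<longleftrightarrow>
     real_polynomial_function q \<and> (\<forall>t x. q (t *\<^sub>R x) = t ^ k * q x)"

text \<open>
  \<open>q\<close> is the degree-\<open>k\<close> term in a decomposition of \<open>p\<close> into homogeneous polynomials. The bound
  \<open>d\<close> may exceed the degree of \<open>p\<close>, since the zero polynomial is homogeneous of every degree.
\<close>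

definition is_homogeneous_part :: "nat \<Rightarrow> (real ^ 'v \<Rightarrow> real) \<Rightarrow> (real ^ 'v \<Rightarrow> real) \<Rightarrow> bool" where
  "is_homogeneous_part k p q \<longleftrightarrow>
     (\<exists>d c. k \<le> d \<and> (\<forall>j\<le>d. homogeneous_polynomial j (c j)) \<and>
            (\<forall>x. p x = (\<Sum>j\<le>d. c j x)) \<and> q = c k)"

text \<open>
  A finite simple connected graph on the vertex set \<open>UNIV :: 'v set\<close>. Undirected edges are pairs of
  opposite arcs; \<open>pair_graph\<close> requires finiteness, symmetry and the absence of loops. The name
  \<open>connected\<close> is qualified because of the topological notion of the same name.
\<close>

definition connected_simple_graph :: "'v pair_pre_digraph \<Rightarrow> bool" where
  "connected_simple_graph G \<longleftrightarrow>
     pair_graph G \<and> pverts G = UNIV \<and> Digraph_Component.connected (with_proj G)"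

end

theory Submission
  imports Defs
begin

text \<open>
  Row \<open>v\<close> of \<open>diag_mat f + diag_mat n ** M\<close> is \<open>f\<^sub>v e\<^sub>v + n\<^sub>v M\<^sub>v\<close>, which is affine in \<open>n\<^sub>v\<close> and free of
  the other variables. Multiplying out the Leibniz formula therefore gives
  \<open>p(n) = \<Sum>\<^sub>S c\<^sub>S \<Prod>\<^sub>v\<^sub>\<in>\<^sub>S n\<^sub>v\<close>, summed over sets of vertices \<open>S\<close>, where \<open>c\<^sub>S\<close> is the determinant
  formed by the rows \<open>M\<^sub>v\<close> for \<open>v \<in> S\<close> and \<open>f\<^sub>v e\<^sub>v\<close> for \<open>v \<notin> S\<close>. Only permutations fixing
  everything outside \<open>S\<close> contribute to it, so \<open>c\<^sub>S\<close> is the principal minor of \<open>M\<close> on \<open>S\<close> times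
  \<open>\<Prod>\<^sub>v\<^sub>\<notin>\<^sub>S f\<^sub>v\<close> (\<open>blowup_poly_multiaffine\<close>).

  For a multi-affine polynomial the Hessian at the origin has zero diagonal and entry
  \<open>c\<^bsub>{v,w}\<^esub>\<close> at \<open>v \<noteq> w\<close> (\<open>hessian_multiaffine\<close>), and its quadratic form is twice the degree 2
  part. For the blowup polynomial, \<open>c\<^bsub>{v,w}\<^esub>\<close> is the two-by-two minor
  \<open>m\<^sub>v\<^sub>v m\<^sub>w\<^sub>w - m\<^sub>v\<^sub>w\<^sup>2\<close> times \<open>\<Prod>\<^sub>u f\<^sub>u / (f\<^sub>v f\<^sub>w)\<close>. This expression also vanishes for \<open>v = w\<close>, so it
  describes all entries at once, and it can be solved for \<open>m\<^sub>v\<^sub>w\<^sup>2\<close> because every \<open>f\<^sub>u\<close> is nonzero.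
\<close>

section \<open>Multi-affine polynomials\<close>

definition multiaffine :: "('v::finite set \<Rightarrow> real) \<Rightarrow> real ^ 'v \<Rightarrow> real" where
  "multiaffine c x = (\<Sum>S\<in>UNIV. c S * (\<Prod>i\<in>S. x $ i))"

lemma has_real_derivative_monomial_axis:
  fixes x :: "real ^ ('v::finite)"
  shows "((\<lambda>t. \<Prod>i\<in>S. (x + t *\<^sub>R axis w 1) $ i) has_real_derivative
           (if w \<in> S then \<Prod>i\<in>S - {w}. x $ i else 0)) (at 0)"
proof (cases "w \<in> S")
  case True
  have *: "(\<Prod>i\<in>S. (x + t *\<^sub>R axis w 1) $ i) = (x $ w + t) * (\<Prod>i\<in>S - {w}. x $ i)" for t
    by (subst prod.remove[OF finite True]) (auto simp: axis_def intro!: prod.cong)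
  show ?thesis
    unfolding * using True by (auto intro!: derivative_eq_intros)
next
  case False
  have *: "(\<Prod>i\<in>S. (x + t *\<^sub>R axis w 1) $ i) = (\<Prod>i\<in>S. x $ i)" for t
    using False by (intro prod.cong) (auto simp: axis_def)
  show ?thesis unfolding * using False by simp
qed

text \<open>
  The derivative is again multi-affine: the coefficient of a set \<open>T\<close> without \<open>w\<close> is the old one of
  \<open>T \<union> {w}\<close>. Keeping this shape lets the lemma be applied twice for the Hessian.
\<close>

lemma partial_deriv_multiaffine:
  "partial_deriv w (multiaffine c) =
     multiaffine (\<lambda>T. if w \<in> T then 0 else c (insert w T))"
proof
  fix x :: "real ^ 'a"
  have "((\<lambda>t. multiaffine c (x + t *\<^sub>R axis w 1)) has_real_derivative
          (\<Sum>S\<in>UNIV. c S * (if w \<in> S then \<Prod>i\<in>S - {w}. x $ i else 0))) (at 0)"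
    unfolding multiaffine_def
    by (intro DERIV_sum DERIV_cmult has_real_derivative_monomial_axis)
  hence "partial_deriv w (multiaffine c) x =
          (\<Sum>S\<in>UNIV. c S * (if w \<in> S then \<Prod>i\<in>S - {w}. x $ i else 0))"
    unfolding partial_deriv_def by (rule DERIV_imp_deriv)
  also have "\<dots> = (\<Sum>S\<in>{S. w \<in> S}. c S * (\<Prod>i\<in>S - {w}. x $ i))"
    by (rule sum.mono_neutral_cong_right) auto
  also have "\<dots> = (\<Sum>T\<in>{T. w \<notin> T}. c (insert w T) * (\<Prod>i\<in>T. x $ i))"
    by (rule sum.reindex_bij_witness[where i = "insert w" and j = "\<lambda>S. S - {w}"])
       (auto simp: insert_absorb)
  also have "\<dots> = multiaffine (\<lambda>T. if w \<in> T then 0 else c (insert w T)) x"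
    unfolding multiaffine_def by (rule sum.mono_neutral_cong_left) auto
  finally show "partial_deriv w (multiaffine c) x = \<dots>" .
qed

lemma multiaffine_zero: "multiaffine c 0 = c {}"
proof -
  have "multiaffine c 0 = (\<Sum>S\<in>{{}}. c S * (\<Prod>i\<in>S. (0 :: real ^ 'a) $ i))"
    unfolding multiaffine_def by (rule sum.mono_neutral_right) auto
  thus ?thesis by simp
qed

lemma hessian_multiaffine:
  "hessian (multiaffine c) 0 $ v $ w = (if v = w then 0 else c {v, w})"
  by (auto simp: hessian_def partial_deriv_multiaffine multiaffine_zero insert_commute)

lemma homogeneous_polynomial_multiaffine:
  assumes "\<And>S. c S \<noteq> 0 \<Longrightarrow> card S = k"
  shows "homogeneous_polynomial k (multiaffine c)"
  unfolding homogeneous_polynomial_def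
proof (intro conjI allI)
  have "real_polynomial_function (\<lambda>x :: real ^ 'a. \<Prod>i\<in>S. x $ i)" for S
    using finite[of S]
  proof (induction S rule: finite_induct)
    case empty
    show ?case by (simp add: real_polynomial_function.intros)
  next
    case (insert i S)
    have "real_polynomial_function (\<lambda>x :: real ^ 'a. x $ i)"
      by (rule real_polynomial_function.intros(1)) (rule bounded_linear_vec_nth)
    from real_polynomial_function.intros(4)[OF this insert.IH] show ?case
      using insert.hyps by simp
  qed
  thus "real_polynomial_function (multiaffine c :: real ^ 'a \<Rightarrow> real)"
    unfolding multiaffine_def[abs_def]
    by (intro real_polynomial_function_sum real_polynomial_function.intros(2,4)) simp_all
next
  fix t :: real and x :: "real ^ 'a"
  have "c S * (\<Prod>i\<in>S. (t *\<^sub>R x) $ i) = t ^ k * (c S * (\<Prod>i\<in>S. x $ i))" for S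
    using assms[of S] by (cases "c S = 0") (auto simp: prod.distrib)
  thus "multiaffine c (t *\<^sub>R x) = t ^ k * multiaffine c x"
    unfolding multiaffine_def sum_distrib_left by (rule sum.cong[OF refl])
qed

lemma is_homogeneous_part_multiaffine:
  fixes c :: "'v::finite set \<Rightarrow> real"
  shows "is_homogeneous_part k (multiaffine c) (multiaffine (\<lambda>S. if card S = k then c S else 0))"
  unfolding is_homogeneous_part_def
proof (intro exI conjI allI impI)
  \<comment> \<open>The number of variables bounds the degree; adding \<open>k\<close> makes the degree \<open>k\<close> term occur even if
    there are fewer than \<open>k\<close> variables.\<close>
  show "k \<le> CARD('v) + k" by simp
  show "homogeneous_polynomial j
          ((\<lambda>j. multiaffine (\<lambda>S. if card S = j then c S else 0)) j)" for j
    by (rule homogeneous_polynomial_multiaffine) (auto split: if_splits)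
  fix x :: "real ^ 'v"
  have le: "card S \<le> CARD('v) + k" for S :: "'v set"
    by (simp add: card_mono trans_le_add1)
  have "(\<Sum>j\<le>CARD('v) + k. multiaffine (\<lambda>S. if card S = j then c S else 0) x) =
          (\<Sum>S\<in>UNIV. (\<Sum>j\<le>CARD('v) + k. if card S = j then c S * (\<Prod>i\<in>S. x $ i) else 0))"
    unfolding multiaffine_def by (subst sum.swap) (auto intro!: sum.cong)
  also have "\<dots> = multiaffine c x"
    unfolding multiaffine_def using le by simp
  finally show "multiaffine c x =
      (\<Sum>j\<le>CARD('v) + k. (\<lambda>j. multiaffine (\<lambda>S. if card S = j then c S else 0)) j x)"
    by simp
qed simp

text \<open>
  Each two-element set arises from two ordered pairs, which accounts for the factor \<open>1 / 2\<close>.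
\<close>

lemma half_hessian_multiaffine:
  fixes c :: "'v::finite set \<Rightarrow> real"
  shows "(1 / 2) * (x \<bullet> (hessian (multiaffine c) 0 *v x)) =
           multiaffine (\<lambda>S. if card S = 2 then c S else 0) x"
proof -
  define P where "P = {(v, w). v \<noteq> (w :: 'v)}"
  define U where "U = (\<lambda>(v, w). {v, w :: 'v})"
  define g where "g = (\<lambda>S. c S * (\<Prod>i\<in>S. x $ i))"
  have "x \<bullet> (hessian (multiaffine c) 0 *v x) =
          (\<Sum>v\<in>UNIV. \<Sum>w\<in>UNIV. if v = w then 0 else g {v, w})"
    unfolding inner_vec_def matrix_vector_mult_def
    by (auto simp: hessian_multiaffine g_def sum_distrib_left intro!: sum.cong)
  also have "\<dots> = (\<Sum>p\<in>UNIV. if fst p = snd p then 0 else g (U p))"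
    unfolding sum.cartesian_product U_def case_prod_unfold UNIV_Times_UNIV ..
  also have "\<dots> = (\<Sum>p\<in>P. g (U p))"
    by (rule sum.mono_neutral_cong_right) (auto simp: P_def)
  also have "\<dots> = (\<Sum>S\<in>{S. card S = 2}. \<Sum>p\<in>{p \<in> P. U p = S}. g (U p))"
    by (rule sum.group[symmetric]) (auto simp: P_def U_def)
  also have "\<dots> = (\<Sum>S\<in>{S. card S = 2}. 2 * g S)"
  proof (rule sum.cong)
    fix S :: "'v set" assume "S \<in> {S. card S = 2}"
    then obtain a b where ab: "S = {a, b}" "a \<noteq> b" by (auto simp: card_2_iff)
    have "{p \<in> P. U p = S} = {(a, b), (b, a)}"
      using ab by (auto simp: P_def U_def doubleton_eq_iff)
    thus "(\<Sum>p\<in>{p \<in> P. U p = S}. g (U p)) = 2 * g S"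
      using ab by (simp add: U_def insert_commute)
  qed simp
  also have "\<dots> = 2 * multiaffine (\<lambda>S. if card S = 2 then c S else 0) x"
    unfolding multiaffine_def sum_distrib_left
    by (rule sum.mono_neutral_cong_left) (auto simp: g_def)
  finally show ?thesis by simp
qed

section \<open>Coefficients of the blowup polynomial\<close>

definition principal_minor :: "real ^ 'v ^ 'v \<Rightarrow> 'v::finite set \<Rightarrow> real" where
  "principal_minor M S = (\<Sum>p | p permutes S. of_int (sign p) * (\<Prod>i\<in>S. M $ i $ p i))"

lemma principal_minor_pair:
  assumes "v \<noteq> w"
  shows "principal_minor M {v, w} = M $ v $ v * M $ w $ w - M $ v $ w * M $ w $ v"
proof -
  have "{p. p permutes {v, w}} = {id, Transposition.transpose v w}"
    by (auto simp: permutes_doubleton_iff)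
  moreover have "id \<noteq> Transposition.transpose v w"
    using assms by (metis id_apply transpose_apply_first)
  ultimately show ?thesis
    using assms by (simp add: principal_minor_def sign_swap_id sign_id)
qed

lemma diag_mat_mult_left: "(diag_mat d ** M) $ v $ w = d $ v * M $ v $ w"
proof -
  have "(\<Sum>k\<in>UNIV. (if v = k then d $ v else 0) * M $ k $ w) =
          (\<Sum>k\<in>UNIV. if v = k then d $ v * M $ k $ w else 0)"
    by (rule sum.cong) auto
  thus ?thesis by (simp add: matrix_matrix_mult_def diag_mat_def)
qed

lemma diag_mat_mult_right: "(M ** diag_mat d) $ v $ w = M $ v $ w * d $ w"
proof -
  have "(\<Sum>k\<in>UNIV. M $ v $ k * (if k = w then d $ k else 0)) =
          (\<Sum>k\<in>UNIV. if k = w then M $ v $ k * d $ k else 0)"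
    by (rule sum.cong) auto
  thus ?thesis by (simp add: matrix_matrix_mult_def diag_mat_def)
qed

lemma blowup_poly_multiaffine:
  "blowup_poly f M = multiaffine (\<lambda>S. principal_minor M S * (\<Prod>i\<in>- S. f $ i))"
proof
  fix n :: "real ^ 'a"
  let ?d = "\<lambda>p i. if i = p i then f $ i else 0"
  let ?t = "\<lambda>p S. of_int (sign p) * ((\<Prod>i\<in>S. n $ i * M $ i $ p i) * (\<Prod>i\<in>- S. ?d p i))"
  have "blowup_poly f M n =
          (\<Sum>p | p permutes UNIV. of_int (sign p) * (\<Prod>i\<in>UNIV. n $ i * M $ i $ p i + ?d p i))"
    by (simp add: blowup_poly_def det_def diag_mat_mult_left add.commute)
       (simp add: diag_mat_def)
  also have "\<dots> = (\<Sum>p | p permutes UNIV. \<Sum>S\<in>UNIV. ?t p S)"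
    by (simp add: prod_add sum_distrib_left Compl_eq_Diff_UNIV)
  also have "\<dots> = (\<Sum>S\<in>UNIV. \<Sum>p | p permutes UNIV. ?t p S)"
    by (rule sum.swap)
  also have "\<dots> = multiaffine (\<lambda>S. principal_minor M S * (\<Prod>i\<in>- S. f $ i)) n"
    unfolding multiaffine_def
  proof (rule sum.cong)
    fix S :: "'a set"
    \<comment> \<open>If a permutation moves some \<open>i \<notin> S\<close>, then its product has the off-diagonal
      factor \<open>0\<close> at \<open>i\<close>.\<close>
    have "(\<Sum>p | p permutes UNIV. ?t p S) =
            (\<Sum>p | p permutes S. of_int (sign p) *
               (\<Prod>i\<in>S. M $ i $ p i) * ((\<Prod>i\<in>- S. f $ i) * (\<Prod>i\<in>S. n $ i)))"
    proof (rule sum.mono_neutral_cong_right)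
      show "\<forall>p\<in>{p. p permutes UNIV} - {p. p permutes S}. ?t p S = 0"
      proof
        fix p assume p: "p \<in> {p. p permutes UNIV} - {p. p permutes S}"
        then obtain i where "i \<notin> S" "p i \<noteq> i" by (auto simp: permutes_def)
        hence "(\<Prod>i\<in>- S. ?d p i) = 0" by (intro prod_zero bexI[of _ i]) auto
        thus "?t p S = 0" by simp
      qed
      show "?t p S = of_int (sign p) * (\<Prod>i\<in>S. M $ i $ p i) *
              ((\<Prod>i\<in>- S. f $ i) * (\<Prod>i\<in>S. n $ i))"
        if "p \<in> {p. p permutes S}" for p
      proof -
        have "(\<Prod>i\<in>- S. ?d p i) = (\<Prod>i\<in>- S. f $ i)"
          using that by (intro prod.cong) (auto simp: permutes_def)
        thus ?thesis by (simp add: prod.distrib)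
      qed
    qed (auto intro: permutes_subset)
    also have "\<dots> = principal_minor M S * (\<Prod>i\<in>- S. f $ i) * (\<Prod>i\<in>S. n $ i)"
      by (simp add: principal_minor_def sum_distrib_right mult.assoc)
    finally show "(\<Sum>p | p permutes UNIV. ?t p S) = \<dots>" .
  qed simp
  finally show "blowup_poly f M n = \<dots>" .
qed

section \<open>The Hessian at the origin\<close>

lemma hessian_blowup_poly_entry:
  fixes M :: "real ^ 'v ^ ('v::finite)"
  assumes "transpose M = M" "\<forall>v. f $ v \<noteq> 0"
  shows "hessian (blowup_poly f M) 0 $ v $ w =
           (\<Prod>u\<in>UNIV. f $ u) * ((M $ v $ v * M $ w $ w - (M $ v $ w)\<^sup>2) / (f $ v * f $ w))"
proof (cases "v = w")
  case True
  thus ?thesis by (simp add: blowup_poly_multiaffine hessian_multiaffine power2_eq_square)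
next
  case False
  have sym: "M $ w $ v = M $ v $ w"
    by (subst assms(1)[symmetric]) (simp add: transpose_def)
  have "(\<Prod>u\<in>UNIV. f $ u) = (\<Prod>u\<in>{v, w}. f $ u) * (\<Prod>u\<in>- {v, w}. f $ u)"
    by (subst prod.union_disjoint[symmetric]) (auto simp: Un_commute)
  thus ?thesis
    using False assms(2) sym
    by (simp add: blowup_poly_multiaffine hessian_multiaffine principal_minor_pair
        power2_eq_square)
qed

lemma matrix_inv_diag_mat:
  fixes f :: "real ^ ('v::finite)"
  assumes "\<forall>v. f $ v \<noteq> 0"
  shows "matrix_inv (diag_mat f) = diag_mat (\<chi> v. 1 / f $ v)"
proof -
  let ?A = "diag_mat f" and ?B = "diag_mat (\<chi> v. 1 / f $ v)"
  have AB: "?A ** ?B = mat 1" and BA: "?B ** ?A = mat 1"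
    using assms
    by (simp_all add: vec_eq_iff diag_mat_mult_left) (simp_all add: diag_mat_def mat_def)
  have "matrix_inv ?A ** ?A = mat 1"
    unfolding matrix_inv_def
    by (rule someI2[where a = ?B]) (use AB BA in auto)
  hence "matrix_inv ?A ** (?A ** ?B) = ?B"
    by (simp add: matrix_mul_assoc)
  thus ?thesis by (simp add: AB)
qed

theorem proposition2p3:
  fixes G :: "('v::finite) pair_pre_digraph"
    and M :: "real ^ 'v ^ 'v" and f :: "real ^ 'v"
  assumes "connected_simple_graph G"
    and "transpose M = M"
    and "\<forall>v. f $ v \<noteq> 0"
  shows "hessian (blowup_poly f M) 0 =
           (\<Prod>v\<in>UNIV. f $ v) *\<^sub>R
             (matrix_inv (diag_mat f) **
              ((columnvector (diagonal_vec M) :: real ^ 1 ^ 'v) **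
                 transpose (columnvector (diagonal_vec M) :: real ^ 1 ^ 'v) - hadamard_square M) **
              matrix_inv (diag_mat f))
         \<and> is_homogeneous_part 2 (blowup_poly f M)
             (\<lambda>n. (1 / 2) * (n \<bullet> (hessian (blowup_poly f M) 0 *v n)))
         \<and> (\<forall>M' :: real ^ 'v ^ 'v.
              transpose M' = M' \<longrightarrow> diagonal_vec M' = diagonal_vec M \<longrightarrow>
              blowup_poly f M' = blowup_poly f M \<longrightarrow>
              hadamard_square M' = hadamard_square M)"
proof (intro conjI allI impI)
  have outer: "((columnvector (diagonal_vec M) :: real ^ 1 ^ 'v) **
      transpose (columnvector (diagonal_vec M) :: real ^ 1 ^ 'v)) $ v $ w =
      M $ v $ v * M $ w $ w" for v w
    by (simp add: matrix_matrix_mult_def columnvector_def transpose_def diagonal_vec_def)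
  show "hessian (blowup_poly f M) 0 =
           (\<Prod>v\<in>UNIV. f $ v) *\<^sub>R
             (matrix_inv (diag_mat f) **
              ((columnvector (diagonal_vec M) :: real ^ 1 ^ 'v) **
                 transpose (columnvector (diagonal_vec M) :: real ^ 1 ^ 'v) - hadamard_square M) **
              matrix_inv (diag_mat f))"
    by (simp add: vec_eq_iff hessian_blowup_poly_entry[OF assms(2,3)]
        matrix_inv_diag_mat[OF assms(3)] diag_mat_mult_left diag_mat_mult_right outer
        hadamard_square_def)
  show "is_homogeneous_part 2 (blowup_poly f M)
          (\<lambda>n. (1 / 2) * (n \<bullet> (hessian (blowup_poly f M) 0 *v n)))"
    unfolding blowup_poly_multiaffine half_hessian_multiaffine
    by (rule is_homogeneous_part_multiaffine)
next
  fix M' :: "real ^ 'v ^ 'v"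
  assume M': "transpose M' = M'" "diagonal_vec M' = diagonal_vec M"
    "blowup_poly f M' = blowup_poly f M"
  have diag: "M' $ v $ v = M $ v $ v" for v
    using M'(2) by (simp add: diagonal_vec_def vec_eq_iff)
  have "(M' $ v $ w)\<^sup>2 = (M $ v $ w)\<^sup>2" for v w
  proof -
    have "(\<Prod>u\<in>UNIV. f $ u) \<noteq> 0" using assms(3) by simp
    thus ?thesis
      using hessian_blowup_poly_entry[OF M'(1) assms(3), of v w]
        hessian_blowup_poly_entry[OF assms(2,3), of v w] assms(3)
      by (simp add: M'(3) diag)
  qed
  thus "hadamard_square M' = hadamard_square M"
    by (simp add: hadamard_square_def)
qed

end
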